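(* For $p^*\in[0,1]$ such that $Q(p^* )=\frac12$ it holds that $\mathbb{T}(p^* )\ge\frac12$.
   Context: There are $n\ge 1$ boxes with independent nonnegative rewards $v_1,\dots,v_n$ whose distributions have no point masses. $Z=\max_{i\in[n]}v_i$ (the prophet), normalized so that $\mathbb{E}[Z]=1$. The quantile function of $Z$ is $Q(p)=\sup\{x\mid \Pr[Z\le x]=p\}$ for $p\in[0,1]$ (values in $\mathbb{R}_{\ge0}\cup\{\infty\}$). Define $\mathbb{T}:[0,1]\to\mathbb{R}_{\ge0}$ by $\mathbb{T}(p)=p\int_p^1 \frac{Q(q)}{q^2}\,dq$ for $p\in(0,1]$, with $\mathbb{T}(0)=\lim_{p\to0^+}\mathbb{T}(p)$. *)

theory Defs
  imports "HOL-Probability.Probability"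
begin

definition prophet :: "nat \<Rightarrow> (nat \<Rightarrow> 'a \<Rightarrow> real) \<Rightarrow> 'a \<Rightarrow> real" where
  "prophet n v \<omega> = Max ((\<lambda>i. v i \<omega>) ` {1..n})"

text \<open>
  The candidates x range over the extended nonnegative reals, so the value at 1 is infinite
  also when the random variable is unbounded (the set of finite candidates is then empty).
\<close>

definition quantile :: "'a measure \<Rightarrow> ('a \<Rightarrow> real) \<Rightarrow> real \<Rightarrow> ennreal" where
  "quantile M Z p = Sup {x. measure M {\<omega> \<in> space M. ennreal (Z \<omega>) \<le> x} = p}"

text \<open>
  If Z is integrable and has no point masses, its quantile function is finite on [0,1), so
  the conversion to real numbers affects the integrand only at q = 1.
\<close>

definition threshold :: "'a measure \<Rightarrow> ('a \<Rightarrow> real) \<Rightarrow> real \<Rightarrow> real" where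
  "threshold M Z p =
     (let T = (\<lambda>p. p * (LINT q:{p..1}|lborel. enn2real (quantile M Z q) / q\<^sup>2))
      in if p = 0 then Lim (at_right 0) T else T p)"

end

theory Submission
  imports Defs
begin

text \<open>
  For \<open>0 \<le> q < 1\<close> one has \<open>Q(q) < x\<close> if and only if \<open>q < F(x)\<close>, where \<open>F\<close> is the
  distribution function of \<open>Z\<close>; hence \<open>Q\<close> is increasing and has the law of \<open>Z\<close> under the uniform
  distribution on \<open>[0,1)\<close>, so that \<open>\<integral>\<^sub>0\<^sup>1 Q = E[Z] = 1\<close>.
  If \<open>p > 0\<close> and \<open>Q(p) = 1/2\<close>, then \<open>Q - 1/2\<close> is nonnegative above \<open>p\<close> and nonpositive
  below, so \<open>\<integral>\<^sub>p\<^sup>1 (Q - 1/2) \<ge> 1/2\<close>. Since \<open>Q(q)/q\<^sup>2 \<ge> (Q(q) - 1/2) + 1/(2q\<^sup>2)\<close> on \<open>[p,1)\<close>,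
  \<open>\<integral>\<^sub>p\<^sup>1 Q(q)/q\<^sup>2 dq \<ge> 1/2 + (1/p - 1)/2 = 1/(2p)\<close>.
  If \<open>p = 0\<close>, the limit defining the threshold exists and equals \<open>Q(0)\<close>, because \<open>Q\<close> is
  right-continuous at \<open>0\<close>.
\<close>

section \<open>The integral of the inverse square\<close>

lemma
  fixes p :: real
  assumes "0 < p" "p \<le> 1"
  shows set_integrable_inverse_square: "set_integrable lborel {p..<1} (\<lambda>q. 1 / q\<^sup>2)"
    and set_integral_inverse_square: "(LINT q:{p..<1}|lborel. 1 / q\<^sup>2) = 1 / p - 1"
proof -
  have "has_bochner_integral lborel (\<lambda>q. indicator {p..1} q *\<^sub>R (1 / q\<^sup>2)) ((- (1 / 1)) - (- (1 / p)))"
  proof (rule has_bochner_integral_FTC_Icc)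
    show "((\<lambda>q. - (1 / q)) has_vector_derivative 1 / q\<^sup>2) (at q within {p..1})"
      if "p \<le> q" "q \<le> 1" for q
      unfolding has_real_derivative_iff_has_vector_derivative[symmetric]
      using that assms by (auto intro!: derivative_eq_intros simp: power2_eq_square)
    show "continuous_on {p..1} (\<lambda>q. 1 / q\<^sup>2)"
      using assms by (auto intro!: continuous_intros)
  qed (use assms in auto)
  then have int: "set_integrable lborel {p..1} (\<lambda>q. 1 / q\<^sup>2)"
    and eq: "(LINT q:{p..1}|lborel. 1 / q\<^sup>2) = 1 / p - 1"
    by (auto simp: has_bochner_integral_iff set_integrable_def set_lebesgue_integral_def)
  show "set_integrable lborel {p..<1} (\<lambda>q. 1 / q\<^sup>2)"
    by (rule set_integrable_subset[OF int]) auto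
  have "(LINT q:{p..<1}|lborel. 1 / q\<^sup>2) = (LINT q:{p..1}|lborel. 1 / q\<^sup>2)"
    by (rule set_integral_discrete_difference[of "{1}"]) auto
  with eq show "(LINT q:{p..<1}|lborel. 1 / q\<^sup>2) = 1 / p - 1"
    by simp
qed

section \<open>The distribution function of a nonnegative variable without atoms\<close>

locale atomless_nonneg_variable = prob_space M for M :: "'a measure" +
  fixes Z :: "'a \<Rightarrow> real"
  assumes measurable_Z [measurable]: "Z \<in> borel_measurable M"
    and Z_nonneg: "\<And>\<omega>. \<omega> \<in> space M \<Longrightarrow> Z \<omega> \<ge> 0"
    and atomless: "\<And>x. measure (distr M borel Z) {x} = 0"
begin

sublocale D: real_distribution "distr M borel Z"
  by simp

abbreviation F :: "real \<Rightarrow> real" where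
  "F \<equiv> cdf (distr M borel Z)"

abbreviation Q :: "real \<Rightarrow> real" where
  "Q q \<equiv> enn2real (quantile M Z q)"

lemma isCont_F: "isCont F x"
  by (simp add: D.isCont_cdf atomless)

lemma F_eq_prob: "F x = prob {\<omega> \<in> space M. Z \<omega> \<le> x}"
  by (auto simp: cdf_def measure_distr vimage_def Int_def intro!: arg_cong[where f=prob])

lemma F_nonpos: "x \<le> 0 \<Longrightarrow> F x = 0"
proof -
  \<comment> \<open>Since \<open>Z\<close> is nonnegative, the events \<open>Z <= 0\<close> and
    \<open>Z = 0\<close> coincide, so \<open>F 0\<close> is the mass of a single point.\<close>
  have "F 0 = measure (distr M borel Z) {0}"
    unfolding cdf_def using Z_nonneg
    by (subst (1 2) measure_distr) (auto intro!: arg_cong[where f=prob] antisym)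
  then show "x \<le> 0 \<Longrightarrow> F x = 0"
    using D.cdf_nondecreasing[of x 0] D.cdf_nonneg[of x] by (simp add: atomless)
qed

lemma F_attains:
  assumes "F a \<le> q" "q \<le> F b" "a \<le> b"
  obtains x where "a \<le> x" "x \<le> b" "F x = q"
  using IVT[of F a q b] assms isCont_F by blast

lemma F_exceeds:
  assumes "q < 1"
  obtains b where "b > a" "F b > q"
proof -
  have "eventually (\<lambda>x. q < F x) at_top"
    using order_tendstoD(1)[OF D.cdf_lim_at_top_prob assms] .
  then have "eventually (\<lambda>x. q < F x \<and> x > a) at_top"
    using eventually_gt_at_top[of a] by eventually_elim auto
  then show ?thesis
    using that by (auto simp: eventually_at_top_linorder)
qed

section \<open>The quantile function as an inverse of the distribution function\<close>

lemma quantile_eq_Sup: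
  assumes "q < 1"
  shows "quantile M Z q = Sup (ennreal ` {x. 0 \<le> x \<and> F x = q})"
proof -
  have "(prob {\<omega> \<in> space M. ennreal (Z \<omega>) \<le> y} = q) \<longleftrightarrow> y \<in> ennreal ` {x. 0 \<le> x \<and> F x = q}" for y
  proof (cases y)
    case (real r)
    have "prob {\<omega> \<in> space M. ennreal (Z \<omega>) \<le> y} = F r"
      unfolding F_eq_prob using real by (intro arg_cong[where f=prob]) auto
    with real show ?thesis by auto
  next
    \<comment> \<open>The infinite candidate has probability 1 and is therefore excluded by
      \<open>q < 1\<close>.\<close>
    case top
    then show ?thesis using assms by (auto simp: prob_space)
  qed
  then show ?thesis
    unfolding quantile_def by (intro arg_cong[where f=Sup]) auto
qed

text \<open>Both directions rest on the intermediate value theorem. If \<open>F x <= q\<close>, the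
  level \<open>q\<close> is attained at some \<open>y >= x\<close>, a candidate in the supremum. If
  \<open>q < F x\<close>, all points of level \<open>q\<close> stay below a point
  \<open>z < x\<close>.\<close>

lemma quantile_less_iff:
  assumes "0 \<le> q" "q < 1" "0 \<le> x"
  shows "quantile M Z q < ennreal x \<longleftrightarrow> q < F x"
proof
  assume less: "quantile M Z q < ennreal x"
  show "q < F x"
  proof (rule ccontr)
    assume "\<not> q < F x"
    obtain b where "b > x" "F b > q" using F_exceeds assms(2) .
    then obtain y where y: "x \<le> y" "F y = q"
      using F_attains[of x q b] \<open>\<not> q < F x\<close> by auto
    then have "ennreal y \<le> quantile M Z q"
      unfolding quantile_eq_Sup[OF assms(2)] using assms by (intro Sup_upper) auto
    with y(1) less show False
      by (meson ennreal_leI leD order_trans)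
  qed
next
  assume less: "q < F x"
  \<comment> \<open>A level strictly between \<open>q\<close> and \<open>F x\<close> keeps the
    supremum itself, and not only each candidate, strictly below \<open>x\<close>.\<close>
  then obtain z where z: "0 \<le> z" "z \<le> x" "F z = (q + F x) / 2"
    using F_attains[of 0 "(q + F x) / 2" x] F_nonpos[of 0] assms by auto
  with less have "z < x" by (cases "z = x") auto
  have "quantile M Z q \<le> ennreal z"
    unfolding quantile_eq_Sup[OF assms(2)]
  proof (rule Sup_least)
    fix y assume "y \<in> ennreal ` {x. 0 \<le> x \<and> F x = q}"
    then obtain r where r: "y = ennreal r" "F r = q" by auto
    have "r \<le> z"
    proof (rule ccontr)
      assume "\<not> r \<le> z"
      then have "F z \<le> F r" by (intro D.cdf_nondecreasing) simp
      with r z less show False by simp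
    qed
    then show "y \<le> ennreal z" using r by (simp add: ennreal_leI)
  qed
  also have "\<dots> < ennreal x"
    using \<open>z < x\<close> z(1) by (simp add: ennreal_lessI)
  finally show "quantile M Z q < ennreal x" .
qed

lemma Q_less_iff:
  assumes "0 \<le> q" "q < 1"
  shows "Q q < x \<longleftrightarrow> q < F x"
proof (cases "0 \<le> x")
  case True
  \<comment> \<open>Such a \<open>b\<close> bounds the quantile, which is thus finite, and
    \<open>enn2real\<close> loses nothing.\<close>
  obtain b where b: "b > 0" "F b > q" using F_exceeds assms(2) .
  then have "quantile M Z q < ennreal b"
    using quantile_less_iff[of q b] assms by simp
  then have "quantile M Z q < top"
    using ennreal_less_top less_trans by blast
  then have "quantile M Z q = ennreal (Q q)" by simp
  then have "quantile M Z q < ennreal x \<longleftrightarrow> Q q < x"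
    using ennreal_less_iff[of "Q q" x] by simp
  then show ?thesis
    using quantile_less_iff[of q x] True assms by simp
next
  case False
  then show ?thesis
    using F_nonpos[of x] assms enn2real_nonneg[of "quantile M Z q"] by linarith
qed

text \<open>Taking \<open>x = Q q\<close> in \<open>Q_less_iff\<close> gives
  \<open>F (Q q) <= q <= q'\<close>, which rules out \<open>Q q' < Q q\<close>.\<close>

lemma Q_mono:
  assumes "0 \<le> q" "q \<le> q'" "q' < 1"
  shows "Q q \<le> Q q'"
  using Q_less_iff[of q "Q q"] Q_less_iff[of q' "Q q"] assms by linarith

section \<open>The law of \<open>Q\<close> under the uniform distribution\<close>

definition unif :: "real measure" where
  "unif = restrict_space lborel {0..<1}"

lemma prob_space_unif: "prob_space unif"
  unfolding unif_def by (rule prob_space_restrict_space) auto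

lemma measurable_Q: "Q \<in> borel_measurable unif"
  unfolding borel_measurable_iff_less
proof
  fix a
  have "{q \<in> space unif. Q q < a} = {0..<1} \<inter> {..<F a}"
    using Q_less_iff by (auto simp: unif_def space_restrict_space)
  then show "{q \<in> space unif. Q q < a} \<in> sets unif"
    by (auto simp: unif_def sets_restrict_space)
qed

text \<open>\<open>Q_less_iff\<close> decides only strict inequalities, so the set where
  \<open>Q q <= x\<close> is squeezed between \<open>{0..<F x}\<close> and \<open>{0..F x}\<close>,
  both of length \<open>F x\<close>.\<close>

lemma distr_Q: "distr unif borel Q = distr M borel Z"
proof (rule cdf_unique)
  interpret U: prob_space unif by (rule prob_space_unif)
  show "real_distribution (distr unif borel Q)"
    using measurable_Q by simp
  show "cdf (distr unif borel Q) = F"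
  proof
    fix x
    let ?S = "{q \<in> {0..<1}. Q q \<le> x}"
    have "?S = Q -` {..x} \<inter> space unif"
      by (auto simp: unif_def space_restrict_space)
    also have "\<dots> \<in> sets unif"
      using measurable_Q by (rule measurable_sets) simp
    finally have sets: "?S \<in> sets lborel"
      by (simp add: unif_def sets_restrict_space_iff)
    have "cdf (distr unif borel Q) x = measure unif ?S"
      unfolding cdf_def using measurable_Q
      by (subst measure_distr) (auto simp: unif_def space_restrict_space intro!: arg_cong2[where f=measure])
    also have "\<dots> = measure lborel ?S"
      unfolding unif_def by (rule measure_restrict_space) auto
    finally have eq: "cdf (distr unif borel Q) x = measure lborel ?S" .
    have 1: "{0..<F x} \<subseteq> ?S"
    proof
      fix q assume q: "q \<in> {0..<F x}"
      then have "q < 1" using D.cdf_bounded_prob[of x] by auto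
      then show "q \<in> ?S" using Q_less_iff[of q x] q by auto
    qed
    have 2: "?S \<subseteq> {0..F x}"
    proof
      fix q assume q: "q \<in> ?S"
      \<comment> \<open>From \<open>Q q <= x\<close> one gets \<open>q < F y\<close> for every
        \<open>y > x\<close>; continuity of \<open>F\<close> lets \<open>y\<close> decrease to
        \<open>x\<close>.\<close>
      have "(F \<longlongrightarrow> F x) (at_right x)"
        using isCont_F[of x] by (auto simp: isCont_def intro: filterlim_at_within_If tendsto_within_subset)
      moreover have "eventually (\<lambda>y. q \<le> F y) (at_right x)"
        unfolding eventually_at_right_field
      proof (intro exI[of _ "x + 1"] conjI allI impI)
        fix y assume "x < y"
        then show "q \<le> F y" using Q_less_iff[of q y] q by auto
      qed simp
      ultimately have "q \<le> F x"
        by (rule tendsto_lowerbound) simp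
      with q show "q \<in> {0..F x}" by simp
    qed
    have Icc: "{0..F x} \<in> fmeasurable lborel"
      by (rule fmeasurableI) (auto simp: D.cdf_nonneg)
    have "measure lborel {0..<F x} \<le> measure lborel ?S"
      using sets 1 2 by (intro measure_mono_fmeasurable fmeasurableI2[OF Icc 2]) auto
    moreover have "measure lborel ?S \<le> measure lborel {0..F x}"
      using sets 2 Icc by (intro measure_mono_fmeasurable) auto
    ultimately show "cdf (distr unif borel Q) x = F x"
      using eq D.cdf_nonneg[of x] by simp
  qed
qed simp

lemma
  assumes "integrable M Z"
  shows set_integrable_Q: "set_integrable lborel {0..<1} Q"
    and set_integral_Q: "(LINT q:{0..<1}|lborel. Q q) = expectation Z"
proof -
  have "integrable (distr unif borel Q) (\<lambda>x. x)"
    unfolding distr_Q using assms by (subst integrable_distr_eq) auto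
  then have "integrable unif Q"
    using measurable_Q by (subst (asm) integrable_distr_eq) auto
  then show "set_integrable lborel {0..<1} Q"
    by (simp add: set_integrable_eq unif_def)
  have "(LINT q:{0..<1}|lborel. Q q) = integral\<^sup>L unif Q"
    by (simp add: unif_def integral_restrict_space set_lebesgue_integral_def)
  also have "\<dots> = integral\<^sup>L (distr unif borel Q) (\<lambda>x. x)"
    using measurable_Q by (subst integral_distr) auto
  also have "\<dots> = expectation Z"
    unfolding distr_Q by (subst integral_distr) auto
  finally show "(LINT q:{0..<1}|lborel. Q q) = expectation Z" .
qed

section \<open>The scaled integral: lower bound and limit at 0\<close>

lemma set_integrable_Q_div_square:
  assumes "integrable M Z" "0 < p"
  shows "set_integrable lborel {p..<1} (\<lambda>q. Q q / q\<^sup>2)"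
proof (rule set_integrable_bound)
  have int: "set_integrable lborel {p..<1} Q"
    using assms by (intro set_integrable_subset[OF set_integrable_Q]) auto
  then show "set_integrable lborel {p..<1} (\<lambda>q. Q q / p\<^sup>2)"
    by simp
  have "(\<lambda>q. (indicator {p..<1} q *\<^sub>R Q q) / q\<^sup>2) \<in> borel_measurable lborel"
    using int unfolding set_integrable_def by measurable
  then show "set_borel_measurable lborel {p..<1} (\<lambda>q. Q q / q\<^sup>2)"
    by (simp add: set_borel_measurable_def)
  show "AE q in lborel. q \<in> {p..<1} \<longrightarrow> norm (Q q / q\<^sup>2) \<le> norm (Q q / p\<^sup>2)"
    using assms(2) by (intro AE_I2) (auto simp: intro!: divide_left_mono power_mono)
qed

text \<open>Removes the endpoint 1, where the quantile is infinite and \<open>Q\<close> has the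
  default value 0; monotonicity of \<open>Q\<close> is available only below it.\<close>

lemma set_integral_atLeastAtMost_eq:
  "(LINT q:{p..1}|lborel. Q q / q\<^sup>2) = (LINT q:{p..<1}|lborel. Q q / q\<^sup>2)"
  by (rule set_integral_discrete_difference[of "{1}"]) auto

lemma scaled_integral_ge_half:
  assumes "integrable M Z" "expectation Z = 1" "0 < p" "p < 1" "Q p = 1/2"
  shows "p * (LINT q:{p..1}|lborel. Q q / q\<^sup>2) \<ge> 1/2"
proof -
  have int_half: "set_integrable lborel {0..<1::real} (\<lambda>q. 1/2 :: real)"
    unfolding set_integrable_def by (intro integrable_scaleR_left integrable_real_indicator) auto
  have int: "set_integrable lborel {0..<1} (\<lambda>q. Q q - 1/2)"
    by (intro set_integral_diff set_integrable_Q int_half assms)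
  have int_p: "set_integrable lborel {p..<1} (\<lambda>q. Q q - 1/2)"
    using assms by (intro set_integrable_subset[OF int]) auto
  have "1/2 = (LINT q:{0..<1}|lborel. Q q - 1/2)"
    using set_integral_diff(2)[OF set_integrable_Q[OF assms(1)] int_half] set_integral_Q[OF assms(1)] assms(2)
    by (simp add: set_lebesgue_integral_def)
  also have "\<dots> \<le> (LINT q:{p..<1}|lborel. Q q - 1/2)"
    unfolding set_lebesgue_integral_def
  proof (rule integral_mono)
    show "indicator {0..<1} q *\<^sub>R (Q q - 1/2) \<le> indicator {p..<1} q *\<^sub>R (Q q - 1/2)" for q
      using Q_mono[of q p] assms by (auto simp: indicator_def)
  qed (use int int_p in \<open>auto simp: set_integrable_def\<close>)
  finally have half: "1/2 \<le> (LINT q:{p..<1}|lborel. Q q - 1/2)" .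
  have int_sq: "set_integrable lborel {p..<1} (\<lambda>q. 1/2 * (1 / q\<^sup>2))"
    using assms by (intro set_integrable_mult_right set_integrable_inverse_square) auto
  have "1/2 + 1/2 * (1 / p - 1) \<le> (LINT q:{p..<1}|lborel. (Q q - 1/2) + 1/2 * (1 / q\<^sup>2))"
    using half set_integral_inverse_square[of p] assms
    by (subst set_integral_add(2)[OF int_p int_sq], subst set_integral_mult_right) simp
  also have "\<dots> \<le> (LINT q:{p..<1}|lborel. Q q / q\<^sup>2)"
  proof (intro set_integral_mono set_integral_add int_p int_sq set_integrable_Q_div_square assms)
    fix q assume q: "q \<in> {p..<1}"
    \<comment> \<open>Write \<open>Q q / q^2\<close> as
      \<open>(Q q - 1/2) / q^2 + (1/2) / q^2\<close>. As the first numerator is nonnegative, that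
      term only shrinks when \<open>1 / q^2\<close> is replaced by 1.\<close>
    have "Q q - 1/2 \<ge> 0" using Q_mono[of p q] q assms by auto
    moreover have "1 \<le> 1 / q\<^sup>2" using q assms by (simp add: power_le_one)
    ultimately have "(Q q - 1/2) * 1 \<le> (Q q - 1/2) * (1 / q\<^sup>2)"
      by (rule mult_left_mono[rotated])
    then show "(Q q - 1/2) + 1/2 * (1 / q\<^sup>2) \<le> Q q / q\<^sup>2"
      by (simp add: algebra_simps diff_divide_distrib)
  qed
  finally have "1/2 + 1/2 * (1 / p - 1) \<le> (LINT q:{p..<1}|lborel. Q q / q\<^sup>2)" .
  then have "p * (1/2 + 1/2 * (1 / p - 1)) \<le> p * (LINT q:{p..<1}|lborel. Q q / q\<^sup>2)"
    using assms by (intro mult_left_mono) auto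
  moreover have "p * (1/2 + 1/2 * (1 / p - 1)) = 1/2"
    using assms by (simp add: field_simps)
  ultimately show ?thesis
    unfolding set_integral_atLeastAtMost_eq by linarith
qed

text \<open>From below, \<open>Q >= Q 0\<close> on \<open>[0,1)\<close> gives at least
  \<open>Q 0 * (1 - p)\<close>. From above, \<open>Q\<close> is close to \<open>Q 0\<close> near 0,
  and the factor \<open>p\<close> makes the contribution of the remaining \<open>q\<close>
  vanish.\<close>

lemma scaled_integral_tendsto:
  assumes "integrable M Z"
  shows "((\<lambda>p. p * (LINT q:{p..1}|lborel. Q q / q\<^sup>2)) \<longlongrightarrow> Q 0) (at_right 0)"
    (is "(?T \<longlongrightarrow> _) _")
proof (rule order_tendstoI)
  have near_0: "eventually (\<lambda>p. 0 < p \<and> p < 1) (at_right (0::real))"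
    by (auto simp: eventually_at_right_field intro!: exI[of _ 1])
  {
    fix a assume "a < Q 0"
    have "((\<lambda>p. Q 0 * (1 - p)) \<longlongrightarrow> Q 0 * (1 - 0)) (at_right 0)"
      by (intro tendsto_intros)
    then have "eventually (\<lambda>p. a < Q 0 * (1 - p)) (at_right 0)"
      using \<open>a < Q 0\<close> by (intro order_tendstoD) auto
    then show "eventually (\<lambda>p. a < ?T p) (at_right 0)"
      using near_0
    proof eventually_elim
      case (elim p)
      have "Q 0 * (1 / p - 1) = (LINT q:{p..<1}|lborel. Q 0 * (1 / q\<^sup>2))"
        using elim by (subst set_integral_mult_right) (simp add: set_integral_inverse_square)
      also have "\<dots> \<le> (LINT q:{p..<1}|lborel. Q q / q\<^sup>2)"
        using elim assms Q_mono[of 0]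
        by (intro set_integral_mono set_integrable_mult_right set_integrable_inverse_square
              set_integrable_Q_div_square) (auto intro!: divide_right_mono)
      finally have "p * (Q 0 * (1 / p - 1)) \<le> ?T p"
        using elim by (simp add: set_integral_atLeastAtMost_eq)
      moreover have "p * (Q 0 * (1 / p - 1)) = Q 0 * (1 - p)"
        using elim by (simp add: field_simps)
      ultimately show ?case
        using elim by linarith
    qed
  next
    fix a assume "Q 0 < a"
    \<comment> \<open>The gap between \<open>Q 0\<close> and \<open>c\<close> makes
      \<open>d = F c\<close> positive, with \<open>Q < c\<close> on \<open>[0,d)\<close>; the gap
      between \<open>c\<close> and \<open>a\<close> absorbs the error
      \<open>p * (expectation Z / d^2)\<close>.\<close>
    define c where "c = (Q 0 + a) / 2"
    have c: "Q 0 < c" "c < a" using \<open>Q 0 < a\<close> by (auto simp: c_def)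
    have "0 \<le> c" using c enn2real_nonneg[of "quantile M Z 0"] by linarith
    define d where "d = F c"
    have "0 < d" using Q_less_iff[of 0 c] c by (simp add: d_def)
    have "((\<lambda>p. c + p * (expectation Z / d\<^sup>2)) \<longlongrightarrow> c + 0 * (expectation Z / d\<^sup>2)) (at_right 0)"
      by (intro tendsto_intros)
    then have "eventually (\<lambda>p. c + p * (expectation Z / d\<^sup>2) < a) (at_right 0)"
      using c by (intro order_tendstoD) auto
    then show "eventually (\<lambda>p. ?T p < a) (at_right 0)"
      using near_0
    proof eventually_elim
      case (elim p)
      have int: "set_integrable lborel {p..<1} (\<lambda>q. Q q / d\<^sup>2)"
        using elim assms
        by (intro set_integrable_divide set_integrable_subset[OF set_integrable_Q]) auto
      have int_sq: "set_integrable lborel {p..<1} (\<lambda>q. c * (1 / q\<^sup>2))"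
        using elim by (intro set_integrable_mult_right set_integrable_inverse_square) auto
      \<comment> \<open>The first term of the majorant serves \<open>q < d\<close>, the second
        \<open>q >= d\<close>. Both are nonnegative, so their sum serves throughout and the interval
        need not be split at \<open>d\<close>.\<close>
      have "(LINT q:{p..<1}|lborel. Q q / q\<^sup>2) \<le> (LINT q:{p..<1}|lborel. c * (1 / q\<^sup>2) + Q q / d\<^sup>2)"
      proof (intro set_integral_mono set_integral_add int int_sq set_integrable_Q_div_square assms)
        fix q assume q: "q \<in> {p..<1}"
        show "Q q / q\<^sup>2 \<le> c * (1 / q\<^sup>2) + Q q / d\<^sup>2"
        proof (cases "q < d")
          case True
          then have "Q q \<le> c" using Q_less_iff[of q c] q elim by (simp add: d_def)
          then have "Q q / q\<^sup>2 \<le> c / q\<^sup>2" by (intro divide_right_mono) auto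
          then show ?thesis by (simp add: add_increasing2)
        next
          case False
          then have "Q q / q\<^sup>2 \<le> Q q / d\<^sup>2"
            using \<open>0 < d\<close> by (intro divide_left_mono power_mono) auto
          then show ?thesis using \<open>0 \<le> c\<close> by (simp add: add_increasing)
        qed
      qed (use elim in auto)
      also have "\<dots> = c * (1 / p - 1) + (LINT q:{p..<1}|lborel. Q q) / d\<^sup>2"
        using set_integral_inverse_square[of p] elim
        by (subst set_integral_add(2)[OF int_sq int], subst set_integral_mult_right) simp
      \<comment> \<open>Enlarging the range yields a bound independent of \<open>p\<close>.\<close>
      also have "(LINT q:{p..<1}|lborel. Q q) \<le> (LINT q:{0..<1}|lborel. Q q)"
        using elim set_integrable_Q[OF assms] set_integrable_subset[OF set_integrable_Q[OF assms], of "{p..<1}"]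
        unfolding set_lebesgue_integral_def set_integrable_def
        by (intro integral_mono) (auto simp: indicator_def)
      finally have "(LINT q:{p..<1}|lborel. Q q / q\<^sup>2) \<le> c * (1 / p - 1) + expectation Z / d\<^sup>2"
        by (simp add: set_integral_Q[OF assms] divide_right_mono)
      then have "?T p \<le> p * (c * (1 / p - 1) + expectation Z / d\<^sup>2)"
        using elim by (simp add: set_integral_atLeastAtMost_eq)
      also have "\<dots> \<le> c + p * (expectation Z / d\<^sup>2)"
        using elim \<open>0 \<le> c\<close> by (simp add: field_simps)
      finally show ?case using elim by linarith
    qed
  }
qed

section \<open>From the scaled integral to the threshold\<close>

lemma quantile_1: "quantile M Z 1 = top"
  unfolding quantile_def by (rule top_le, rule Sup_upper) (simp add: prob_space)

lemma threshold_ge_half: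
  assumes "expectation Z = 1" "p \<in> {0..1}" "quantile M Z p = ennreal (1/2)"
  shows "threshold M Z p \<ge> 1/2"
proof -
  \<comment> \<open>A nonintegrable function has integral 0 by convention, so expectation 1 forces
    integrability.\<close>
  have int: "integrable M Z"
    using assms(1) not_integrable_integral_eq by fastforce
  have Q: "Q p = 1/2"
    unfolding assms(3) by (rule enn2real_ennreal) simp
  \<comment> \<open>At \<open>p = 1\<close> the range of integration is a point and the threshold is
    0; the infinite quantile excludes this case.\<close>
  have "p \<noteq> 1" using assms(3) quantile_1 ennreal_neq_top by metis
  show ?thesis
  proof (cases "p = 0")
    \<comment> \<open>Here \<open>threshold\<close> is a \<open>Lim\<close>, which is determined
      because the limit exists; its value is \<open>Q 0 = 1/2\<close>.\<close>
    case True
    with Q tendsto_Lim[OF _ scaled_integral_tendsto[OF int]] show ?thesis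
      by (simp add: threshold_def)
  next
    case False
    then show ?thesis
      using scaled_integral_ge_half[OF int assms(1) _ _ Q] \<open>p \<noteq> 1\<close> assms(2)
      by (simp add: threshold_def)
  qed
qed

end

section \<open>The prophet is nonnegative and has no atoms\<close>

lemma atomless_nonneg_prophet:
  assumes "prob_space M" "n \<ge> 1"
    and meas: "\<And>i. i \<in> {1..n} \<Longrightarrow> v i \<in> borel_measurable M"
    and nonneg: "\<And>i \<omega>. i \<in> {1..n} \<Longrightarrow> \<omega> \<in> space M \<Longrightarrow> v i \<omega> \<ge> 0"
    and atomless: "\<And>i x. i \<in> {1..n} \<Longrightarrow> measure (distr M borel (v i)) {x} = 0"
  shows "atomless_nonneg_variable M (prophet n v)"
proof -
  interpret prob_space M by fact
  have ne: "(\<lambda>i. v i \<omega>) ` {1..n} \<noteq> {}" for \<omega> using \<open>n \<ge> 1\<close> by auto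
  have attained: "\<exists>i\<in>{1..n}. prophet n v \<omega> = v i \<omega>" for \<omega>
    using Max_in[OF _ ne[of \<omega>]] by (auto simp: prophet_def)
  have meas_prophet [measurable]: "prophet n v \<in> borel_measurable M"
    unfolding prophet_def[abs_def] using meas by (intro borel_measurable_Max) auto
  show ?thesis
  proof
    show "prophet n v \<in> borel_measurable M" by (rule meas_prophet)
    show "prophet n v \<omega> \<ge> 0" if "\<omega> \<in> space M" for \<omega>
      using attained[of \<omega>] nonneg that by force
    show "measure (distr M borel (prophet n v)) {x} = 0" for x
    proof -
      \<comment> \<open>The maximum is attained, so it equals \<open>x\<close> only if some
        \<open>v i\<close> does: a finite union of null events.\<close>
      have "v i -` {x} \<inter> space M \<in> null_sets M" if "i \<in> {1..n}" for i
        using atomless[OF that, of x] meas[OF that]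
        by (auto simp: measure_distr emeasure_eq_measure intro!: null_setsI measurable_sets)
      then have "(\<Union>i\<in>{1..n}. v i -` {x} \<inter> space M) \<in> null_sets M"
        by (intro null_sets_UN') auto
      moreover have "prophet n v -` {x} \<inter> space M \<subseteq> (\<Union>i\<in>{1..n}. v i -` {x} \<inter> space M)"
      proof
        fix \<omega> assume "\<omega> \<in> prophet n v -` {x} \<inter> space M"
        with attained[of \<omega>] show "\<omega> \<in> (\<Union>i\<in>{1..n}. v i -` {x} \<inter> space M)" by auto
      qed
      moreover have "prophet n v -` {x} \<inter> space M \<in> sets M"
        using meas_prophet by (rule measurable_sets) simp
      ultimately have "prophet n v -` {x} \<inter> space M \<in> null_sets M"
        by (blast intro: null_sets_subset)
      then show ?thesis
        by (simp add: measure_distr null_setsD1 measure_eq_0_null_sets)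
    qed
  qed
qed

theorem claim9:
  fixes M :: "'a measure" and n :: nat and v :: "nat \<Rightarrow> 'a \<Rightarrow> real" and pstar :: real
  assumes "prob_space M"
    and "n \<ge> 1"
    and "prob_space.indep_vars M (\<lambda>_. borel) v {1..n}"
    and "\<And>i \<omega>. i \<in> {1..n} \<Longrightarrow> \<omega> \<in> space M \<Longrightarrow> v i \<omega> \<ge> 0"
    and "\<And>i x. i \<in> {1..n} \<Longrightarrow> measure (distr M borel (v i)) {x} = 0"
    and "prob_space.expectation M (prophet n v) = 1"
    and "pstar \<in> {0..1}"
    and "quantile M (prophet n v) pstar = ennreal (1/2)"
  shows "threshold M (prophet n v) pstar \<ge> 1/2"
proof -
  have "v i \<in> borel_measurable M" if "i \<in> {1..n}" for i
    using assms(3) that by (simp add: prob_space.indep_vars_def[OF assms(1)])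
  then interpret atomless_nonneg_variable M "prophet n v"
    by (intro atomless_nonneg_prophet assms)
  show ?thesis
    by (rule threshold_ge_half) fact+
qed

end
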